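(* Let $T$ be a contraction on a complex Hilbert space $\mathcal{H}$ which is a $2$-quasi-isometry. If $T$ satisfies $|T|\le|\mathrm{Re}\,T|$, then $T$ is self-adjoint.
   Context: A contraction is a bounded operator of norm at most $1$. A bounded operator $T$ on $\mathcal{H}$ is an $m$-quasi-isometry ($m\ge1$ an integer) if $T|_{\mathcal{R}(T^m)}$ is an isometry, where $\mathcal{R}(T^m)$ is the range of $T^m$, i.e. $\|Tx\|=\|x\|$ for all $x\in\mathcal{R}(T^m)$; here $m=2$. $|T|=(T^*T)^{1/2}$ and $\mathrm{Re}\,T=\frac12(T+T^* )$; inequalities between self-adjoint operators are in the usual order. *)

theory Defs
  imports "HOL-Analysis.Analysis"
begin

(* The inner product is linear in the first argument. *)

class complex_inner = real_normed_vector +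
  fixes scaleC :: "complex \<Rightarrow> 'a \<Rightarrow> 'a"  (infixr "*\<^sub>C" 75)
    and cinner :: "'a \<Rightarrow> 'a \<Rightarrow> complex"
  assumes scaleC_add_right: "c *\<^sub>C (x + y) = c *\<^sub>C x + c *\<^sub>C y"
    and scaleC_add_left: "(c + d) *\<^sub>C x = c *\<^sub>C x + d *\<^sub>C x"
    and scaleC_scaleC: "c *\<^sub>C (d *\<^sub>C x) = (c * d) *\<^sub>C x"
    and scaleC_of_real: "complex_of_real r *\<^sub>C x = r *\<^sub>R x"
    and cinner_commute: "cinner x y = cnj (cinner y x)"
    and cinner_add_left: "cinner (x + y) z = cinner x z + cinner y z"
    and cinner_scaleC_left: "cinner (c *\<^sub>C x) y = c * cinner x y"
    and cinner_self: "cinner x x = complex_of_real ((norm x)\<^sup>2)"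

class chilbert_space = complex_inner + complete_space

instantiation complex :: chilbert_space
begin

definition scaleC_complex :: "complex \<Rightarrow> complex \<Rightarrow> complex"
  where "scaleC_complex c z = c * z"

definition cinner_complex :: "complex \<Rightarrow> complex \<Rightarrow> complex"
  where "cinner_complex z w = z * cnj w"

instance
  by standard
    (simp_all add: scaleC_complex_def cinner_complex_def algebra_simps
       scaleR_conv_of_real complex_norm_square[symmetric])

end

definition bounded_clinear :: "('a::complex_inner \<Rightarrow> 'b::complex_inner) \<Rightarrow> bool"
  where "bounded_clinear T \<longleftrightarrow> bounded_linear T \<and> (\<forall>c x. T (c *\<^sub>C x) = c *\<^sub>C T x)"

definition contraction :: "('a::complex_inner \<Rightarrow> 'a) \<Rightarrow> bool"
  where "contraction T \<longleftrightarrow> bounded_clinear T \<and> onorm T \<le> 1"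

definition quasi_isometry :: "nat \<Rightarrow> ('a::complex_inner \<Rightarrow> 'a) \<Rightarrow> bool"
  where "quasi_isometry m T \<longleftrightarrow>
    m \<ge> 1 \<and> bounded_clinear T \<and> (\<forall>x \<in> range (T ^^ m). norm (T x) = norm x)"

(* For a bounded operator on a Hilbert space the adjoint exists (Riesz) and is unique,
   so the description below denotes it. *)
definition cadjoint :: "('a::chilbert_space \<Rightarrow> 'a) \<Rightarrow> ('a \<Rightarrow> 'a)"
  where "cadjoint T = (THE S. \<forall>x y. cinner (T x) y = cinner x (S y))"

definition self_adjoint :: "('a::chilbert_space \<Rightarrow> 'a) \<Rightarrow> bool"
  where "self_adjoint T \<longleftrightarrow> bounded_clinear T \<and> cadjoint T = T"

definition op_Re :: "('a::chilbert_space \<Rightarrow> 'a) \<Rightarrow> ('a \<Rightarrow> 'a)"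
  where "op_Re T = (\<lambda>x. (1/2) *\<^sub>R (T x + cadjoint T x))"

definition positive_op :: "('a::chilbert_space \<Rightarrow> 'a) \<Rightarrow> bool"
  where "positive_op A \<longleftrightarrow> self_adjoint A \<and> (\<forall>x. cinner (A x) x \<in> \<real>\<^sub>\<ge>\<^sub>0)"

definition op_le :: "('a::chilbert_space \<Rightarrow> 'a) \<Rightarrow> ('a \<Rightarrow> 'a) \<Rightarrow> bool"
  where "op_le A B \<longleftrightarrow> positive_op (\<lambda>x. B x - A x)"

(* A positive operator has exactly one positive square root. *)
definition op_sqrt :: "('a::chilbert_space \<Rightarrow> 'a) \<Rightarrow> ('a \<Rightarrow> 'a)"
  where "op_sqrt A = (THE S. positive_op S \<and> S \<circ> S = A)"

definition op_abs :: "('a::chilbert_space \<Rightarrow> 'a) \<Rightarrow> ('a \<Rightarrow> 'a)"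
  where "op_abs T = op_sqrt (cadjoint T \<circ> T)"

end

(* The idea: let M be the range of T^2.  Since T is a contraction and isometric on M,
   T*T = 1 and |T| = 1 on M, so |T| <= |Re T| <= 1 makes Re T isometric on M.  For x in M the mean
   of the vectors Tx, T*x, both of norm at most |x|, thus has norm |x|, which forces Tx = T*x.
   Hence M reduces T, and on N, the orthogonal complement of M, T^2 = T*^2 = 0 and
   4 (Re T)^2 = TT* + T*T.  There |T| and |Re T| commute, and on vectors T*w the squares of
   |Re T| and |T|/2 agree; so |Re T| = |T|/2 >= |T| on them, which gives T = 0 on N.
   Finally T - T* is skew-adjoint and vanishes on M and on N, so it is zero. *)

theory Submission imports Defs begin

section \<open>Complex inner products\<close>

lemma cinner_add_right: "cinner x (y + z) = cinner x y + cinner x (z::'a::complex_inner)"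
  by (metis cinner_add_left cinner_commute complex_cnj_add)

lemma cinner_scaleC_right: "cinner x (c *\<^sub>C y) = cnj c * cinner x (y::'a::complex_inner)"
  by (metis cinner_commute cinner_scaleC_left complex_cnj_mult)

lemma cinner_scaleR_left: "cinner (r *\<^sub>R x) y = of_real r * cinner x (y::'a::complex_inner)"
  by (metis cinner_scaleC_left scaleC_of_real)

lemma cinner_scaleR_right: "cinner x (r *\<^sub>R y) = of_real r * cinner x (y::'a::complex_inner)"
  by (metis cinner_scaleC_right scaleC_of_real complex_cnj_complex_of_real)

lemma cinner_zero_left [simp]: "cinner 0 (y::'a::complex_inner) = 0"
  using cinner_scaleR_left[of 0 0 y] by simp

lemma cinner_zero_right [simp]: "cinner (y::'a::complex_inner) 0 = 0"
  using cinner_scaleR_right[of y 0 0] by simp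

lemma cinner_minus_left: "cinner (- x) y = - cinner x (y::'a::complex_inner)"
  using cinner_scaleR_left[of "-1" x y] by simp

lemma cinner_minus_right: "cinner x (- y) = - cinner x (y::'a::complex_inner)"
  using cinner_scaleR_right[of x "-1" y] by simp

lemma cinner_diff_left: "cinner (x - y) z = cinner x z - cinner y (z::'a::complex_inner)"
  using cinner_add_left[of x "- y" z] by (simp add: cinner_minus_left)

lemma cinner_diff_right: "cinner x (y - z) = cinner x y - cinner x (z::'a::complex_inner)"
  using cinner_add_right[of x y "- z"] by (simp add: cinner_minus_right)

lemmas cinner_linear =
  cinner_add_left cinner_add_right cinner_diff_left cinner_diff_right
  cinner_minus_left cinner_minus_right cinner_scaleR_left cinner_scaleR_right

lemma scaleC_scaleR: "c *\<^sub>C (r *\<^sub>R x) = r *\<^sub>R (c *\<^sub>C (x::'a::complex_inner))"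
  by (metis mult.commute scaleC_of_real scaleC_scaleC)

lemma scaleC_diff_right: "c *\<^sub>C (x - y) = c *\<^sub>C x - c *\<^sub>C (y::'a::complex_inner)"
  by (metis add_diff_cancel diff_add_cancel scaleC_add_right)

lemma scaleC_zero_right [simp]: "c *\<^sub>C (0::'a::complex_inner) = 0"
  using scaleC_scaleR[of c 0 0] by simp

lemma Re_cinner_self: "Re (cinner x x) = (norm (x::'a::complex_inner))\<^sup>2"
  by (simp add: cinner_self)

lemma Re_cinner_commute: "Re (cinner x y) = Re (cinner y (x::'a::complex_inner))"
  by (subst cinner_commute) simp

lemma norm_add_square:
  "(norm (x + y))\<^sup>2 = (norm x)\<^sup>2 + 2 * Re (cinner x y) + (norm (y::'a::complex_inner))\<^sup>2"
  using Re_cinner_commute[of x y]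
  by (simp add: Re_cinner_self[symmetric] cinner_linear)

lemma norm_diff_square:
  "(norm (x - y))\<^sup>2 = (norm x)\<^sup>2 - 2 * Re (cinner x y) + (norm (y::'a::complex_inner))\<^sup>2"
  using Re_cinner_commute[of x y]
  by (simp add: Re_cinner_self[symmetric] cinner_linear)

lemma parallelogram:
  "(norm (x + y))\<^sup>2 + (norm (x - y))\<^sup>2 = 2 * (norm x)\<^sup>2 + 2 * (norm (y::'a::complex_inner))\<^sup>2"
  by (simp add: norm_add_square norm_diff_square)

lemma Re_cinner_le: "Re (cinner x y) \<le> norm x * norm (y::'a::complex_inner)"
proof -
  have "(norm (x + y))\<^sup>2 \<le> (norm x + norm y)\<^sup>2"
    by (intro power_mono norm_triangle_ineq) auto
  then show ?thesis by (simp add: norm_add_square power2_sum)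
qed

lemma abs_Re_cinner_le: "\<bar>Re (cinner x y)\<bar> \<le> norm x * norm (y::'a::complex_inner)"
  using Re_cinner_le[of x y] Re_cinner_le[of "- x" y] by (simp add: cinner_minus_left)

text \<open>The class makes the norm homogeneous for real scalars only; \<open>cinner_self\<close>
  at \<open>c *\<^sub>C x\<close> forces the complex case.\<close>

lemma norm_scaleC: "norm (c *\<^sub>C x) = cmod c * norm (x::'a::complex_inner)"
proof -
  have "complex_of_real ((norm (c *\<^sub>C x))\<^sup>2) = (c * cnj c) * of_real ((norm x)\<^sup>2)"
    by (simp only: cinner_self[symmetric] cinner_scaleC_left cinner_scaleC_right mult_ac)
  also have "\<dots> = complex_of_real ((cmod c * norm x)\<^sup>2)"
    by (simp add: complex_norm_square[symmetric] power_mult_distrib del: complex_mult_cnj)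
  finally show ?thesis
    by (simp only: of_real_eq_iff) (simp add: power2_eq_iff_nonneg)
qed

text \<open>The factor 2 comes from bounding real and imaginary parts separately, the latter through
  multiplication of \<open>x\<close> by the imaginary unit. This crude bound serves continuity of
  the inner product.\<close>

lemma cmod_cinner_le: "cmod (cinner x y) \<le> 2 * norm x * norm (y::'a::complex_inner)"
proof -
  have "\<bar>Im (cinner x y)\<bar> = \<bar>Re (cinner (\<i> *\<^sub>C x) y)\<bar>"
    by (simp add: cinner_scaleC_left)
  also have "\<dots> \<le> norm x * norm y"
    using abs_Re_cinner_le[of "\<i> *\<^sub>C x" y] by (simp add: norm_scaleC)
  finally show ?thesis
    using abs_Re_cinner_le[of x y] cmod_le[of "cinner x y"] by linarith
qed

lemma bounded_linear_cinner_left: "bounded_linear (\<lambda>x. cinner x (y::'a::complex_inner))"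
  by (rule bounded_linear_intro[where K = "2 * norm y"])
    (use cmod_cinner_le[of _ y] in \<open>simp_all add: cinner_linear scaleR_conv_of_real mult_ac\<close>)

lemma cinner_right_eqI: "(\<And>x. cinner x y = cinner x z) \<Longrightarrow> y = (z::'a::complex_inner)"
proof -
  assume *: "\<And>x. cinner x y = cinner x z"
  have "(norm (y - z))\<^sup>2 = Re (cinner (y - z) y) - Re (cinner (y - z) z)"
    by (simp add: Re_cinner_self[symmetric] cinner_diff_right)
  then show "y = z" by (simp add: *)
qed

section \<open>Adjoints\<close>

lemma Cauchy_of_dist_square_le:
  fixes s :: "nat \<Rightarrow> 'a::metric_space"
  assumes "\<And>m n. (dist (s m) (s n))\<^sup>2 \<le> e m + e n" and "e \<longlonglongrightarrow> (0::real)"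
  shows "Cauchy s"
proof (rule metric_CauchyI)
  fix r :: real assume "r > 0"
  then have "\<forall>\<^sub>F n in sequentially. e n < r\<^sup>2 / 2"
    using assms(2) by (intro order_tendstoD) auto
  then obtain N where N: "\<And>n. n \<ge> N \<Longrightarrow> e n < r\<^sup>2 / 2"
    by (auto simp: eventually_sequentially)
  have "dist (s m) (s n) < r" if "m \<ge> N" "n \<ge> N" for m n
  proof -
    have "(dist (s m) (s n))\<^sup>2 < r\<^sup>2"
      using assms(1)[of m n] N[OF that(1)] N[OF that(2)] by linarith
    then show ?thesis
      using \<open>r > 0\<close> by (simp add: power2_less_imp_less)
  qed
  then show "\<exists>M. \<forall>m\<ge>M. \<forall>n\<ge>M. dist (s m) (s n) < r" by blast
qed

text \<open>The quadratic vanishes at t = 0, so 0 is a minimum and the derivative there, 2d, must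
  vanish. First variations of minimisers and of nonnegative forms are handled this way.\<close>

lemma quadratic_nonneg_linear_coeff:
  fixes d k :: real
  assumes "\<And>t. 0 \<le> 2 * t * d + t\<^sup>2 * k"
  shows "d = 0"
proof -
  define c where "c = \<bar>k\<bar> + 1"
  have c: "c > 0" "k \<le> c" by (auto simp: c_def)
  \<comment> \<open>This t minimises the quadratic with \<open>k\<close> replaced by the positive
    upper bound \<open>c\<close>.\<close>
  have "0 \<le> 2 * (- d / c) * d + (- d / c)\<^sup>2 * k" by (rule assms)
  also have "\<dots> \<le> 2 * (- d / c) * d + (- d / c)\<^sup>2 * c"
    using c by (intro add_left_mono mult_left_mono) auto
  also have "\<dots> = - (d\<^sup>2 / c)" using c by (simp add: field_simps power2_eq_square)
  finally have "d\<^sup>2 / c \<le> 0" by simp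
  then show ?thesis using c by (simp add: divide_le_0_iff)
qed

text \<open>The representing vector minimises \<open>\<lambda>x. (norm x)\<^sup>2 - 2 * Re (f x)\<close>;
  minimising sequences are Cauchy by the parallelogram law.\<close>

lemma riesz_representation:
  fixes f :: "'a::chilbert_space \<Rightarrow> complex"
  assumes lin: "bounded_linear f" and cl: "\<And>c x. f (c *\<^sub>C x) = c * f x"
  shows "\<exists>y. \<forall>x. f x = cinner x y"
proof -
  interpret f: bounded_linear f by fact
  define J where "J x = (norm x)\<^sup>2 - 2 * Re (f x)" for x
  obtain K where K: "\<And>x. norm (f x) \<le> norm x * K" using f.bounded by blast
  \<comment> \<open>Completing the square: norm x squared minus 2 K norm x is at least minus K
    squared.\<close>
  have lower: "- K\<^sup>2 \<le> J x" for x
  proof -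
    have "Re (f x) \<le> norm x * K"
      using K[of x] complex_Re_le_cmod[of "f x"] by linarith
    moreover have "0 \<le> (norm x - K)\<^sup>2" by simp
    ultimately show ?thesis by (simp add: J_def power2_diff)
  qed
  define m where "m = (INF x. J x)"
  have bdd: "bdd_below (range J)" using lower by (intro bdd_belowI[where m = "- K\<^sup>2"]) auto
  have m_le: "m \<le> J x" for x unfolding m_def using bdd by (simp add: cINF_lower)
  have "\<exists>x. J x < m + inverse (real (Suc n))" for n
    using cInf_lessD[of "range J" "m + inverse (real (Suc n))"] by (auto simp: m_def)
  then obtain s where s: "\<And>n. J (s n) < m + inverse (real (Suc n))" by metis
  have mid: "(dist (s a) (s b))\<^sup>2 \<le> 2 * inverse (real (Suc a)) + 2 * inverse (real (Suc b))" for a b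
  proof -
    have "4 * J ((1/2) *\<^sub>R (s a + s b)) = (norm (s a + s b))\<^sup>2 - 4 * Re (f (s a)) - 4 * Re (f (s b))"
      by (simp add: J_def f.scaleR f.add power_divide add_divide_distrib del: scaleR_add_right)
    \<comment> \<open>The linear terms of \<open>J\<close> cancel at the midpoint, where
      \<open>J\<close> is still at least \<open>m\<close>; only the two excesses over
      \<open>m\<close> remain.\<close>
    then have "(norm (s a - s b))\<^sup>2 = 2 * J (s a) + 2 * J (s b) - 4 * J ((1/2) *\<^sub>R (s a + s b))"
      using parallelogram[of "s a" "s b"] by (simp add: J_def)
    then show ?thesis
      using m_le[of "(1/2) *\<^sub>R (s a + s b)"] s[of a] s[of b] by (simp add: dist_norm)
  qed
  have inv0: "(\<lambda>n. 2 * inverse (real (Suc n))) \<longlonglongrightarrow> 0"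
    using tendsto_mult_left[OF LIMSEQ_inverse_real_of_nat, of 2] by simp
  have "Cauchy s" by (rule Cauchy_of_dist_square_le[OF mid inv0])
  then obtain y where y: "s \<longlonglongrightarrow> y" using Cauchy_convergent convergent_def by blast
  have "(\<lambda>n. J (s n)) \<longlonglongrightarrow> J y"
    unfolding J_def by (intro tendsto_intros y f.tendsto)
  moreover have "(\<lambda>n. m + inverse (real (Suc n))) \<longlonglongrightarrow> m + 0"
    by (intro tendsto_intros LIMSEQ_inverse_real_of_nat)
  ultimately have "J y \<le> m"
    using s by (intro LIMSEQ_le[of "\<lambda>n. J (s n)" "J y"]) (auto intro: less_imp_le)
  then have min: "J y \<le> J x" for x using m_le[of x] by linarith
  have re: "Re (f x) = Re (cinner x y)" for x
  proof -
    \<comment> \<open>Twice \<open>d\<close> is the derivative of \<open>J\<close> at the minimiser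
      \<open>y\<close> in direction \<open>x\<close>.\<close>
    define d where "d = Re (cinner x y) - Re (f x)"
    have step: "0 \<le> 2 * t * d + t\<^sup>2 * (norm x)\<^sup>2" for t
    proof -
      have "J (y + t *\<^sub>R x) = J y + 2 * t * d + t\<^sup>2 * (norm x)\<^sup>2"
        using Re_cinner_commute[of x y]
        by (simp add: J_def d_def f.scaleR f.add norm_add_square cinner_linear
            power_mult_distrib algebra_simps)
      then show ?thesis using min[of "y + t *\<^sub>R x"] by linarith
    qed
    have "d = 0" by (rule quadratic_nonneg_linear_coeff) (rule step)
    then show ?thesis by (simp add: d_def)
  qed
  have "f x = cinner x y" for x
  proof (rule complex_eqI)
    show "Re (f x) = Re (cinner x y)" by (rule re)
    show "Im (f x) = Im (cinner x y)"
      using re[of "\<i> *\<^sub>C x"] by (simp add: cl cinner_scaleC_left)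
  qed
  then show ?thesis by blast
qed

section \<open>Bounded complex-linear maps and their adjoints\<close>

lemma bounded_clinearD:
  assumes "bounded_clinear T"
  shows "bounded_linear T" "T (c *\<^sub>C x) = c *\<^sub>C T x" "T (x + y) = T x + T y"
    "T (x - y) = T x - T y" "T (- x) = - T x" "T 0 = 0" "T (r *\<^sub>R x) = r *\<^sub>R T x"
  using assms
  by (auto simp: bounded_clinear_def bounded_linear.linear linear_add linear_diff linear_neg
      linear_0 linear_scale)

lemma bounded_clinear_zero: "bounded_clinear (\<lambda>x. 0)"
  by (simp add: bounded_clinear_def)

lemma bounded_clinear_ident: "bounded_clinear (\<lambda>x. x)"
  by (simp add: bounded_clinear_def bounded_linear_ident)

lemma bounded_clinear_add:
  "bounded_clinear S \<Longrightarrow> bounded_clinear T \<Longrightarrow> bounded_clinear (\<lambda>x. S x + T x)"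
  by (simp add: bounded_clinear_def bounded_linear_add scaleC_add_right)

lemma bounded_clinear_diff:
  "bounded_clinear S \<Longrightarrow> bounded_clinear T \<Longrightarrow> bounded_clinear (\<lambda>x. S x - T x)"
  by (simp add: bounded_clinear_def bounded_linear_sub scaleC_diff_right)

lemma bounded_clinear_scaleR: "bounded_clinear T \<Longrightarrow> bounded_clinear (\<lambda>x. r *\<^sub>R T x)"
  unfolding bounded_clinear_def
  by (elim conjE, intro conjI)
    (rule bounded_linear_compose[OF bounded_linear_scaleR_right[of r], of T], assumption,
      simp add: scaleC_scaleR)

lemma bounded_clinear_compose:
  "bounded_clinear S \<Longrightarrow> bounded_clinear T \<Longrightarrow> bounded_clinear (\<lambda>x. S (T x))"
  unfolding bounded_clinear_def
  by (elim conjE, intro conjI) (rule bounded_linear_compose[of S T], assumption+, simp)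

lemmas bounded_clinear_intros =
  bounded_clinear_zero bounded_clinear_ident bounded_clinear_add bounded_clinear_diff
  bounded_clinear_scaleR

lemma cadjoint_eqI:
  assumes "\<And>x y. cinner (T x) y = cinner x (S y)"
  shows "cadjoint T = S"
  unfolding cadjoint_def
proof (rule the_equality)
  show "\<forall>x y. cinner (T x) y = cinner x (S y)" using assms by blast
  show "S' = S" if "\<forall>x y. cinner (T x) y = cinner x (S' y)" for S'
    by (rule ext, rule cinner_right_eqI) (metis that assms)
qed

text \<open>For fixed \<open>y\<close> the left side is a bounded functional of \<open>x\<close>, so
  Riesz supplies the value at \<open>y\<close>. This existence is what makes the description in
  \<open>cadjoint\<close> denote.\<close>

lemma cinner_cadjoint:
  assumes T: "bounded_clinear T"
  shows "cinner (T x) y = cinner x (cadjoint T y)"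
proof -
  note TD = bounded_clinearD[OF T]
  have "\<exists>z. \<forall>x. cinner (T x) y = cinner x z" for y
    using bounded_linear_compose[OF bounded_linear_cinner_left TD(1)]
    by (rule riesz_representation) (simp add: TD(2) cinner_scaleC_left)
  then obtain S where S: "\<And>x y. cinner (T x) y = cinner x (S y)" by metis
  have "cadjoint T = S" by (rule cadjoint_eqI) (rule S)
  then show ?thesis by (simp add: S)
qed

lemma cinner_cadjoint_left:
  assumes "bounded_clinear T"
  shows "cinner (cadjoint T x) y = cinner x (T y)"
  by (metis assms cinner_cadjoint cinner_commute)

lemma bounded_clinear_cadjoint:
  assumes T: "bounded_clinear T"
  shows "bounded_clinear (cadjoint T)"
proof -
  note adj = cinner_cadjoint[OF T, symmetric]
  obtain K where K: "\<And>x. norm (T x) \<le> norm x * K" "0 \<le> K"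
    using bounded_linear.nonneg_bounded[OF bounded_clinearD(1)[OF T]] by blast
  have "norm (cadjoint T x) \<le> norm x * K" for x
  proof -
    have "(norm (cadjoint T x))\<^sup>2 = Re (cinner (T (cadjoint T x)) x)"
      by (simp add: Re_cinner_self[symmetric] adj)
    also have "\<dots> \<le> norm (T (cadjoint T x)) * norm x" by (rule Re_cinner_le)
    also have "\<dots> \<le> (norm (cadjoint T x) * K) * norm x" by (intro mult_right_mono K) auto
    finally have "norm (cadjoint T x) * norm (cadjoint T x) \<le> norm (cadjoint T x) * (norm x * K)"
      by (simp add: power2_eq_square mult_ac)
    then show ?thesis
      using K(2) by (cases "cadjoint T x = 0") (simp_all add: mult_le_cancel_left)
  qed
  moreover have "cadjoint T (x + y) = cadjoint T x + cadjoint T y" for x y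
    by (rule cinner_right_eqI) (simp add: adj cinner_linear)
  moreover have "cadjoint T (r *\<^sub>R x) = r *\<^sub>R cadjoint T x" for r x
    by (rule cinner_right_eqI) (simp add: adj cinner_linear)
  moreover have "cadjoint T (c *\<^sub>C x) = c *\<^sub>C cadjoint T x" for c x
    by (rule cinner_right_eqI) (simp add: adj cinner_scaleC_right)
  ultimately show ?thesis
    by (auto simp: bounded_clinear_def intro!: bounded_linear_intro[of _ K])
qed

section \<open>Self-adjoint and positive operators\<close>

lemma self_adjoint_iff:
  "self_adjoint T \<longleftrightarrow> bounded_clinear T \<and> (\<forall>x y. cinner (T x) y = cinner x (T y))"
  using cinner_cadjoint[of T] cadjoint_eqI[of T T] by (auto simp: self_adjoint_def)

lemma self_adjointD:
  assumes "self_adjoint T"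
  shows "bounded_clinear T" "cinner (T x) y = cinner x (T y)"
  using assms by (auto simp: self_adjoint_iff)

lemma cinner_self_adjoint_real:
  assumes "self_adjoint T"
  shows "cinner (T x) x = of_real (Re (cinner (T x) x))"
proof -
  have "cnj (cinner (T x) x) = cinner (T x) x"
    using cinner_commute[of x "T x"] self_adjointD(2)[OF assms, of x x] by simp
  then show ?thesis by (simp add: complex_eq_iff)
qed

lemma positive_op_iff:
  "positive_op T \<longleftrightarrow> self_adjoint T \<and> (\<forall>x. 0 \<le> Re (cinner (T x) x))"
proof -
  have "cinner (T x) x \<in> \<real>\<^sub>\<ge>\<^sub>0 \<longleftrightarrow> 0 \<le> Re (cinner (T x) x)" if "self_adjoint T" for x
    using cinner_self_adjoint_real[OF that, of x]
    by (metis Re_complex_of_real nonneg_Reals_cases nonneg_Reals_of_real_iff)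
  then show ?thesis by (auto simp: positive_op_def)
qed

lemma op_leD: "op_le A B \<Longrightarrow> Re (cinner (A x) x) \<le> Re (cinner (B x) x)"
  by (auto simp: op_le_def positive_op_iff cinner_diff_left)

lemma norm_self_adjoint_square:
  assumes "self_adjoint S"
  shows "(norm (S x))\<^sup>2 = Re (cinner (S (S x)) x)"
  using self_adjointD(2)[OF assms, of "S x" x] by (simp add: Re_cinner_self[symmetric])

text \<open>No square root of \<open>S\<close> is available yet, so the form is varied from
  \<open>z\<close> in direction \<open>S z\<close>: it stays nonnegative, is 0 at the start, and has
  linear coefficient twice the square of norm (S z).\<close>

lemma positive_op_eq_zero:
  assumes S: "positive_op S" and z: "Re (cinner (S z) z) = 0"
  shows "S z = 0"
proof -
  have sa: "self_adjoint S" using S by (simp add: positive_op_iff)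
  note SD = bounded_clinearD[OF self_adjointD(1)[OF sa]]
  have "0 \<le> 2 * t * (norm (S z))\<^sup>2 + t\<^sup>2 * Re (cinner (S (S z)) (S z))" for t
  proof -
    have "Re (cinner (S (z + t *\<^sub>R S z)) (z + t *\<^sub>R S z))
        = 2 * t * (norm (S z))\<^sup>2 + t\<^sup>2 * Re (cinner (S (S z)) (S z))"
      using z by (simp add: SD cinner_linear norm_self_adjoint_square[OF sa, symmetric]
          Re_cinner_self power2_eq_square algebra_simps)
    then show ?thesis using S by (metis positive_op_iff)
  qed
  then have "(norm (S z))\<^sup>2 = 0" by (rule quadratic_nonneg_linear_coeff)
  then show ?thesis by simp
qed

text \<open>With z = Pu - Qu the hypotheses give (P + Q) z = 0, so both forms vanish at z, hence Pz
  = Qz = 0, and the square of norm z is the inner product of u with Pz - Qz. Everything is required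
  at the single vector \<open>u\<close>, so the lemma also applies to operators that agree only on
  part of the space.\<close>

lemma commuting_positive_eq:
  assumes P: "positive_op P" and Q: "positive_op Q"
    and comm: "P (Q u) = Q (P u)" and sq: "P (P u) = Q (Q u)"
  shows "P u = Q u"
proof -
  have sa: "self_adjoint P" "self_adjoint Q" using P Q by (auto simp: positive_op_iff)
  note PD = bounded_clinearD[OF self_adjointD(1)[OF sa(1)]]
  note QD = bounded_clinearD[OF self_adjointD(1)[OF sa(2)]]
  define z where "z = P u - Q u"
  have "P z + Q z = 0" using comm sq by (simp add: z_def PD QD)
  then have "Re (cinner (P z) z) + Re (cinner (Q z) z) = 0"
    by (metis cinner_add_left cinner_zero_left plus_complex.sel(1) zero_complex.sel(1))
  moreover have "0 \<le> Re (cinner (P z) z)" "0 \<le> Re (cinner (Q z) z)"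
    using P Q by (auto simp: positive_op_iff)
  ultimately have "P z = 0" "Q z = 0"
    by (auto intro!: positive_op_eq_zero[OF P] positive_op_eq_zero[OF Q])
  then have "cinner z z = 0"
    using cinner_diff_left[of "P u" "Q u" z]
    by (simp add: self_adjointD(2)[OF sa(1)] self_adjointD(2)[OF sa(2)] flip: z_def)
  then show ?thesis by (simp add: z_def cinner_self)
qed

section \<open>Square roots of positive operators\<close>

text \<open>With \<open>X = 1 - A\<close> the iterates converge to \<open>Y = (X + Y\<^sup>2) / 2\<close>,
  so that \<open>(1 - Y)\<^sup>2 = A\<close>.  Convergence follows by comparison with the scalar case \<open>X = 1\<close>.\<close>

primrec sqrt_iter :: "('a::real_vector \<Rightarrow> 'a) \<Rightarrow> nat \<Rightarrow> 'a \<Rightarrow> 'a" where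
  "sqrt_iter X 0 = (\<lambda>x. 0)"
| "sqrt_iter X (Suc n) = (\<lambda>x. (1/2) *\<^sub>R (X x + sqrt_iter X n (sqrt_iter X n x)))"

primrec sqrt_majorant :: "nat \<Rightarrow> real" where
  "sqrt_majorant 0 = 0"
| "sqrt_majorant (Suc n) = (1 + (sqrt_majorant n)\<^sup>2) / 2"

lemma sqrt_majorant_bounds: "0 \<le> sqrt_majorant n \<and> sqrt_majorant n \<le> 1"
  by (induction n) (auto simp: power_le_one)

text \<open>The increment is half the square of 1 minus the current value.\<close>

lemma sqrt_majorant_Suc: "sqrt_majorant n \<le> sqrt_majorant (Suc n)"
  using zero_le_power2[of "1 - sqrt_majorant n"] by (simp add: power2_diff)

lemma convergent_sqrt_majorant: "convergent sqrt_majorant"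
  using sqrt_majorant_bounds
  by (intro Bseq_mono_convergent BseqI'[where K = 1])
    (auto intro: lift_Suc_mono_le[of sqrt_majorant, OF sqrt_majorant_Suc])

lemma bounded_clinear_sqrt_iter:
  "bounded_clinear X \<Longrightarrow> bounded_clinear (sqrt_iter X n)"
  by (induction n) (auto intro!: bounded_clinear_intros bounded_clinear_compose[of "sqrt_iter X _"]
      simp del: scaleR_add_right)

text \<open>The iterates are polynomials in \<open>X\<close>; this property survives in the limit
  and makes the square root commute with whatever commutes with \<open>A\<close>.\<close>

lemma sqrt_iter_commute:
  assumes "bounded_linear C" and "\<And>x. C (X x) = X (C x)"
  shows "C (sqrt_iter X n x) = sqrt_iter X n (C x)"
proof (induction n arbitrary: x)
  case 0
  show ?case using linear_0[OF bounded_linear.linear[OF assms(1)]] by simp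
next
  case (Suc n)
  then show ?case
    using assms by (simp add: linear_add linear_scale bounded_linear.linear)
qed

lemma sqrt_iter_symmetric:
  assumes "\<And>x y. cinner (X x) y = cinner x (X y)"
  shows "cinner (sqrt_iter X n x) y = cinner x (sqrt_iter X n (y::'a::complex_inner))"
  using assms by (induction n arbitrary: x y) (simp_all add: cinner_linear)

lemma norm_sqrt_iter_le:
  assumes "\<And>x. norm (X x) \<le> norm x"
  shows "norm (sqrt_iter X n x) \<le> sqrt_majorant n * norm (x::'a::real_normed_vector)"
proof (induction n arbitrary: x)
  case (Suc n)
  let ?Y = "sqrt_iter X n"
  have "norm (?Y (?Y x)) \<le> sqrt_majorant n * (sqrt_majorant n * norm x)"
    using sqrt_majorant_bounds[of n]
    by (intro order_trans[OF Suc.IH[of "?Y x"]] mult_left_mono Suc.IH) simp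
  then have "norm (X x + ?Y (?Y x)) \<le> norm x + sqrt_majorant n * (sqrt_majorant n * norm x)"
    using assms[of x] norm_triangle_ineq[of "X x" "?Y (?Y x)"] by linarith
  then show ?case by (simp add: power2_eq_square distrib_right del: scaleR_add_right)
qed simp

text \<open>The splitting ZZ - YY = Z(Z - Y) + (Z - Y)Y is mirrored by the scalars: b(b - a) + (b -
  a)a is the difference of the squares of b and a. So the scalar recursion dominates the operator
  one.\<close>

lemma norm_sqrt_iter_Suc_diff_le:
  assumes X: "bounded_clinear X" and contr: "\<And>x. norm (X x) \<le> norm x"
  shows "norm (sqrt_iter X (Suc n) x - sqrt_iter X n x)
    \<le> (sqrt_majorant (Suc n) - sqrt_majorant n) * norm x"
proof (induction n arbitrary: x)
  case 0
  then show ?case using contr[of x] by simp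
next
  case (Suc n)
  let ?Y = "sqrt_iter X n" and ?Z = "sqrt_iter X (Suc n)"
  let ?a = "sqrt_majorant n" and ?b = "sqrt_majorant (Suc n)"
  note ZD = bounded_clinearD[OF bounded_clinear_sqrt_iter[OF X, of "Suc n"]]
  have ab: "0 \<le> ?a" "0 \<le> ?b" "0 \<le> ?b - ?a"
    using sqrt_majorant_bounds sqrt_majorant_Suc[of n] by (auto simp del: sqrt_majorant.simps)
  have "?Z (?Z x) - ?Y (?Y x) = ?Z (?Z x - ?Y x) + (?Z (?Y x) - ?Y (?Y x))"
    unfolding ZD by (simp del: sqrt_iter.simps)
  also have "norm \<dots> \<le> ?b * norm (?Z x - ?Y x) + (?b - ?a) * norm (?Y x)"
    using norm_sqrt_iter_le[of X "Suc n" "?Z x - ?Y x", OF contr] Suc.IH[of "?Y x"]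
    by (intro norm_triangle_mono)
  also have "\<dots> \<le> ?b * ((?b - ?a) * norm x) + (?b - ?a) * (?a * norm x)"
    using ab by (intro add_mono mult_left_mono Suc.IH norm_sqrt_iter_le contr)
  also have "\<dots> = (?b\<^sup>2 - ?a\<^sup>2) * norm x"
    by (simp add: power2_eq_square algebra_simps del: sqrt_majorant.simps)
  finally have *: "norm (?Z (?Z x) - ?Y (?Y x)) \<le> (?b\<^sup>2 - ?a\<^sup>2) * norm x" .
  have diff: "sqrt_iter X (Suc (Suc n)) x - ?Z x = (1/2) *\<^sub>R (?Z (?Z x) - ?Y (?Y x))"
    by (simp only: sqrt_iter.simps(2)[of X "Suc n"] sqrt_iter.simps(2)[of X n, THEN fun_cong, of x]
        scaleR_add_right scaleR_diff_right) simp
  have "sqrt_majorant (Suc (Suc n)) - ?b = (?b\<^sup>2 - ?a\<^sup>2) / 2"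
    by (simp only: sqrt_majorant.simps(2)[of "Suc n"]) (simp add: field_simps)
  then have majorant: "(sqrt_majorant (Suc (Suc n)) - ?b) * norm x = ((?b\<^sup>2 - ?a\<^sup>2) * norm x) / 2"
    by (simp only: times_divide_eq_left)
  then show ?case
    unfolding diff majorant using * by (simp del: sqrt_iter.simps sqrt_majorant.simps)
qed

lemma norm_sqrt_iter_diff_le:
  assumes X: "bounded_clinear X" and contr: "\<And>x. norm (X x) \<le> norm x" and "m \<le> n"
  shows "norm (sqrt_iter X n x - sqrt_iter X m x) \<le> (sqrt_majorant n - sqrt_majorant m) * norm x"
  using \<open>m \<le> n\<close>
proof (induction n rule: dec_induct)
  case (step n)
  have "norm (sqrt_iter X (Suc n) x - sqrt_iter X m x)
      \<le> norm (sqrt_iter X (Suc n) x - sqrt_iter X n x) + norm (sqrt_iter X n x - sqrt_iter X m x)"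
    using norm_triangle_ineq[of "sqrt_iter X (Suc n) x - sqrt_iter X n x"
        "sqrt_iter X n x - sqrt_iter X m x"] by (simp del: sqrt_iter.simps)
  then show ?case
    using step.IH norm_sqrt_iter_Suc_diff_le[OF X contr, of n x]
    by (simp add: algebra_simps del: sqrt_iter.simps sqrt_majorant.simps)
qed simp

lemma sqrt_iter_limit:
  fixes X :: "'a::chilbert_space \<Rightarrow> 'a"
  assumes X: "bounded_clinear X" and contr: "\<And>x. norm (X x) \<le> norm x"
  shows "\<exists>Y. bounded_clinear Y \<and> (\<forall>x. (\<lambda>n. sqrt_iter X n x) \<longlonglongrightarrow> Y x) \<and>
    (\<forall>x. norm (Y x) \<le> norm x) \<and> (\<forall>x. Y x = (1/2) *\<^sub>R (X x + Y (Y x)))"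
proof -
  let ?S = "sqrt_iter X"
  note SD = bounded_clinearD[OF bounded_clinear_sqrt_iter[OF X]]
  have S_le: "norm (?S n x) \<le> norm x" for n x
    using norm_sqrt_iter_le[OF contr, of n x] sqrt_majorant_bounds[of n]
    by (meson mult_left_le_one_le norm_ge_zero order_trans)
  have "Cauchy (\<lambda>n. ?S n x)" for x
  proof (rule CauchyI')
    fix e :: real assume "e > 0"
    have "Cauchy sqrt_majorant" using convergent_sqrt_majorant by (rule convergent_Cauchy)
    \<comment> \<open>The added 1 keeps the denominator positive when \<open>x\<close> is 0.\<close>
    then obtain N where N: "\<And>m n. m \<ge> N \<Longrightarrow> n \<ge> N \<Longrightarrow>
        dist (sqrt_majorant m) (sqrt_majorant n) < e / (norm x + 1)"
      using \<open>e > 0\<close> unfolding Cauchy_def by (meson add_nonneg_pos divide_pos_pos norm_ge_zero zero_less_one)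
    have "norm (?S m x - ?S n x) < e" if "m \<ge> N" "n > m" for m n
    proof -
      have "sqrt_majorant n - sqrt_majorant m < e / (norm x + 1)"
        using N[of n m] that by (simp add: dist_real_def)
      moreover have "norm x + 1 > 0" by (simp add: add_nonneg_pos)
      ultimately have "(sqrt_majorant n - sqrt_majorant m) * (norm x + 1) < e"
        by (simp add: pos_less_divide_eq)
      moreover have "sqrt_majorant m \<le> sqrt_majorant n"
        using that lift_Suc_mono_le[of sqrt_majorant, OF sqrt_majorant_Suc] by simp
      ultimately show ?thesis
        using norm_sqrt_iter_diff_le[OF X contr, of m n x] that
        by (simp add: norm_minus_commute algebra_simps)
    qed
    then show "\<exists>M. \<forall>m\<ge>M. \<forall>n>m. dist (?S m x) (?S n x) < e"
      by (auto simp: dist_norm)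
  qed
  then have "\<exists>y. (\<lambda>n. ?S n x) \<longlonglongrightarrow> y" for x
    using Cauchy_convergent convergent_def by blast
  then obtain Y where Y: "\<And>x. (\<lambda>n. ?S n x) \<longlonglongrightarrow> Y x" by metis
  have Y_le: "norm (Y x) \<le> norm x" for x
    by (rule Lim_bounded[OF tendsto_norm[OF Y], of 0]) (simp add: S_le)
  have add: "Y (x + y) = Y x + Y y" for x y
    using Y[of "x + y"] tendsto_add[OF Y[of x] Y[of y]] by (auto simp: SD intro: LIMSEQ_unique)
  have scaleR: "Y (r *\<^sub>R x) = r *\<^sub>R Y x" for r x
    using Y[of "r *\<^sub>R x"] tendsto_scaleR[OF tendsto_const Y[of x]]
    by (auto simp: SD intro: LIMSEQ_unique)
  have scaleC: "Y (c *\<^sub>C x) = c *\<^sub>C Y x" for c x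
  proof -
    have "bounded_linear (\<lambda>x::'a. c *\<^sub>C x)"
      by (rule bounded_linear_intro[where K = "cmod c"])
        (simp_all add: scaleC_add_right scaleC_scaleR norm_scaleC mult.commute)
    from bounded_linear.tendsto[OF this Y[of x]] show ?thesis
      using Y[of "c *\<^sub>C x"] by (auto simp: SD(2) intro: LIMSEQ_unique)
  qed
  have lin: "bounded_clinear Y"
    unfolding bounded_clinear_def
    by (auto intro!: bounded_linear_intro[of Y 1] simp: add scaleR scaleC Y_le)
  \<comment> \<open>Convergence is only pointwise, so the moving operator is controlled by
    \<open>S_le\<close>: applied to the null sequence \<open>?S n x - Y x\<close> it gives a null
    sequence.\<close>
  have "(\<lambda>n. ?S n (?S n x)) \<longlonglongrightarrow> Y (Y x)" for x
  proof -
    have "(\<lambda>n. norm (?S n x - Y x)) \<longlonglongrightarrow> 0"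
      using Y[of x] by (simp add: LIM_zero tendsto_norm_zero)
    then have "(\<lambda>n. ?S n (?S n x - Y x)) \<longlonglongrightarrow> 0"
      by (rule Lim_null_comparison[rotated]) (simp add: S_le)
    from tendsto_add[OF this Y[of "Y x"]] show ?thesis by (simp add: SD)
  qed
  then have "(\<lambda>n. ?S (Suc n) x) \<longlonglongrightarrow> (1/2) *\<^sub>R (X x + Y (Y x))" for x
    by (simp, intro tendsto_intros)
  then have "Y x = (1/2) *\<^sub>R (X x + Y (Y x))" for x
    using LIMSEQ_Suc[OF Y[of x]] LIMSEQ_unique by blast
  with lin Y Y_le show ?thesis by blast
qed

text \<open>The norm bound plays the part of positivity: for self-adjoint \<open>A\<close> it says
  that A lies between 0 and 2. The last clause is used twice, for uniqueness of the root and for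
  commutation of moduli.\<close>

lemma positive_sqrt_exists:
  assumes A: "self_adjoint A" and contr: "\<And>x. norm (x - A x) \<le> norm x"
  shows "\<exists>B. positive_op B \<and> (\<forall>x. B (B x) = A x) \<and>
    (\<forall>C. bounded_linear C \<longrightarrow> (\<forall>x. C (A x) = A (C x)) \<longrightarrow> (\<forall>x. C (B x) = B (C x)))"
proof -
  define X where "X = (\<lambda>x. x - A x)"
  have X: "bounded_clinear X" unfolding X_def
    by (rule bounded_clinear_diff[OF bounded_clinear_ident self_adjointD(1)[OF A]])
  have X_le: "norm (X x) \<le> norm x" for x unfolding X_def by (rule contr)
  obtain Y where "bounded_clinear Y" "\<forall>x. (\<lambda>n. sqrt_iter X n x) \<longlonglongrightarrow> Y x"
    "\<forall>x. norm (Y x) \<le> norm x" "\<forall>x. Y x = (1/2) *\<^sub>R (X x + Y (Y x))"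
    using sqrt_iter_limit[OF X X_le] by (elim exE conjE)
  note Y = this(1) this(2-4)[rule_format]
  note YD = bounded_clinearD[OF Y(1)]
  define B where "B = (\<lambda>x. x - Y x)"
  have Xsym: "cinner (X x) y = cinner x (X y)" for x y
    by (simp add: X_def cinner_linear self_adjointD(2)[OF A])
  have Ysym: "cinner (Y x) y = cinner x (Y y)" for x y
  proof -
    note lim = bounded_linear.tendsto[OF bounded_linear_cinner_left Y(2)]
    \<comment> \<open>Continuity is at hand in the left argument only, so the limit on the right is
      taken through conjugation.\<close>
    have "(\<lambda>n. cnj (cinner (sqrt_iter X n y) x)) \<longlonglongrightarrow> cnj (cinner (Y y) x)"
      by (intro tendsto_cnj lim)
    then have "(\<lambda>n. cinner (sqrt_iter X n x) y) \<longlonglongrightarrow> cinner x (Y y)"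
      by (simp add: cinner_commute[symmetric] sqrt_iter_symmetric[of X, OF Xsym])
    from LIMSEQ_unique[OF lim[of x y] this] show ?thesis .
  qed
  have "bounded_clinear B"
    unfolding B_def by (rule bounded_clinear_diff[OF bounded_clinear_ident Y(1)])
  moreover have "cinner (B x) y = cinner x (B y)" for x y
    by (simp add: B_def cinner_linear Ysym)
  moreover have "0 \<le> Re (cinner (B x) x)" for x
  proof -
    have "Re (cinner (Y x) x) \<le> norm x * norm x"
      by (rule order_trans[OF Re_cinner_le mult_right_mono[OF Y(3)]]) simp
    then show ?thesis by (simp add: B_def cinner_diff_left Re_cinner_self power2_eq_square)
  qed
  ultimately have pos: "positive_op B" by (simp add: positive_op_iff self_adjoint_iff)
  have sq: "B (B x) = A x" for x
  proof -
    have "Y x + Y x = X x + Y (Y x)"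
      using arg_cong[OF Y(4)[of x], of "scaleR 2"] by (simp add: scaleR_2 del: scaleR_add_right)
    then show ?thesis by (simp add: B_def X_def YD algebra_simps)
  qed
  have commute: "C (B x) = B (C x)"
    if C: "bounded_linear C" and comm: "\<And>x. C (A x) = A (C x)" for C x
  proof -
    have "C (X x) = X (C x)" for x
      by (simp add: X_def comm linear_diff[OF bounded_linear.linear[OF C]])
    then have "(\<lambda>n. C (sqrt_iter X n x)) \<longlonglongrightarrow> Y (C x)"
      using Y(2) by (simp add: sqrt_iter_commute[OF C])
    from LIMSEQ_unique[OF bounded_linear.tendsto[OF C Y(2)] this]
    have "C (Y x) = Y (C x)" .
    then show ?thesis by (simp add: B_def linear_diff[OF bounded_linear.linear[OF C]])
  qed
  show ?thesis
    by (intro exI[of _ B] conjI allI impI pos sq) (simp add: commute)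
qed

text \<open>Any positive root \<open>S\<close> commutes with its square \<open>A\<close>, hence with
  the constructed root \<open>B\<close>, and \<open>commuting_positive_eq\<close> identifies the
  two. So the description in \<open>op_sqrt\<close> denotes \<open>B\<close>.\<close>

lemma op_sqrt:
  assumes A: "self_adjoint A" and contr: "\<And>x. norm (x - A x) \<le> norm x"
  shows positive_op_sqrt: "positive_op (op_sqrt A)"
    and op_sqrt_sqrt: "op_sqrt A (op_sqrt A x) = A x"
    and op_sqrt_commute:
      "bounded_linear C \<Longrightarrow> (\<And>x. C (A x) = A (C x)) \<Longrightarrow> C (op_sqrt A x) = op_sqrt A (C x)"
proof -
  obtain B where B: "positive_op B" "\<forall>x. B (B x) = A x"
    "\<forall>C. bounded_linear C \<longrightarrow> (\<forall>x. C (A x) = A (C x)) \<longrightarrow> (\<forall>x. C (B x) = B (C x))"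
    using positive_sqrt_exists[OF A contr] by (elim exE conjE)
  have "op_sqrt A = B"
    unfolding op_sqrt_def
  proof (rule the_equality)
    show "positive_op B \<and> B \<circ> B = A" using B(1,2) by (auto simp: fun_eq_iff)
  next
    fix S assume S: "positive_op S \<and> S \<circ> S = A"
    then have SS: "S (S x) = A x" for x by (auto simp: fun_eq_iff)
    have "bounded_linear S"
      using S by (simp add: positive_op_iff self_adjoint_iff bounded_clinear_def)
    moreover have "S (A x) = A (S x)" for x by (simp add: SS[symmetric])
    ultimately have "S (B x) = B (S x)" for x using B(3) by simp
    then have "S x = B x" for x
      by (rule commuting_positive_eq[OF conjunct1[OF S] B(1)]) (simp add: SS B(2))
    then show "S = B" by blast
  qed
  then show "positive_op (op_sqrt A)" "op_sqrt A (op_sqrt A x) = A x"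
    using B(1,2) by auto
  show "C (op_sqrt A x) = op_sqrt A (C x)"
    if "bounded_linear C" "\<And>x. C (A x) = A (C x)"
    using B(3) that unfolding \<open>op_sqrt A = B\<close> by simp
qed

section \<open>Contractions, their moduli and real parts\<close>

lemma norm_contraction_le:
  assumes "contraction T"
  shows "norm (T x) \<le> norm x"
proof -
  have "norm (T x) \<le> onorm T * norm x"
    using assms by (intro onorm) (auto simp: contraction_def bounded_clinear_def)
  also have "\<dots> \<le> norm x"
    using assms by (intro mult_left_le_one_le) (auto simp: contraction_def bounded_clinear_def onorm_pos_le)
  finally show ?thesis .
qed

lemma norm_cadjoint_contraction_le:
  assumes "contraction T"
  shows "norm (cadjoint T x) \<le> norm x"
proof -
  have lin: "bounded_clinear T" using assms by (simp add: contraction_def)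
  have "(norm (cadjoint T x))\<^sup>2 = Re (cinner (T (cadjoint T x)) x)"
    by (simp add: Re_cinner_self[symmetric] cinner_cadjoint[OF lin])
  also have "\<dots> \<le> norm (T (cadjoint T x)) * norm x" by (rule Re_cinner_le)
  also have "\<dots> \<le> norm (cadjoint T x) * norm x"
    by (intro mult_right_mono norm_contraction_le assms) auto
  finally show ?thesis
    by (cases "cadjoint T x = 0") (simp_all add: power2_eq_square)
qed

lemma op_abs_contraction:
  assumes T: "contraction T"
  shows positive_op_abs: "positive_op (op_abs T)"
    and op_abs_op_abs: "op_abs T (op_abs T x) = cadjoint T (T x)"
    and op_abs_commute: "bounded_linear C \<Longrightarrow>
      (\<And>x. C (cadjoint T (T x)) = cadjoint T (T (C x))) \<Longrightarrow> C (op_abs T x) = op_abs T (C x)"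
proof -
  have lin: "bounded_clinear T" using T by (simp add: contraction_def)
  have sa: "self_adjoint (cadjoint T \<circ> T)"
    unfolding self_adjoint_iff comp_def
    using bounded_clinear_compose[OF bounded_clinear_cadjoint[OF lin] lin]
    by (simp add: cinner_cadjoint_left[OF lin] cinner_cadjoint[OF lin])
  have "norm (x - (cadjoint T \<circ> T) x) \<le> norm x" for x
  proof -
    \<comment> \<open>Expanding the square subtracts twice the square of norm (T x), while the last
      term adds it back at most once.\<close>
    have "Re (cinner x (cadjoint T (T x))) = (norm (T x))\<^sup>2"
      by (simp add: cinner_cadjoint[OF lin, symmetric] Re_cinner_self)
    moreover have "(norm (cadjoint T (T x)))\<^sup>2 \<le> (norm (T x))\<^sup>2"
      by (intro power_mono norm_cadjoint_contraction_le T) auto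
    ultimately have "(norm (x - cadjoint T (T x)))\<^sup>2 \<le> (norm x)\<^sup>2"
      using zero_le_power2[of "norm (T x)"] unfolding norm_diff_square by linarith
    then show ?thesis by (auto dest: power2_le_imp_le)
  qed
  note sqrt = op_sqrt[OF sa this]
  show "positive_op (op_abs T)" "op_abs T (op_abs T x) = cadjoint T (T x)"
    using sqrt(1,2) by (simp_all add: op_abs_def comp_def)
  show "C (op_abs T x) = op_abs T (C x)"
    if "bounded_linear C" "\<And>x. C (cadjoint T (T x)) = cadjoint T (T (C x))"
    unfolding op_abs_def by (rule sqrt(3)[of C]) (simp_all add: that)
qed

lemma norm_op_abs:
  assumes "contraction T"
  shows "norm (op_abs T x) = norm (T x)"
proof -
  have lin: "bounded_clinear T" using assms by (simp add: contraction_def)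
  have "self_adjoint (op_abs T)" using positive_op_abs[OF assms] by (simp add: positive_op_iff)
  then have "(norm (op_abs T x))\<^sup>2 = (norm (T x))\<^sup>2"
    by (simp add: norm_self_adjoint_square op_abs_op_abs[OF assms] cinner_cadjoint_left[OF lin]
        Re_cinner_self)
  then show ?thesis by (simp add: power2_eq_iff_nonneg)
qed

lemma self_adjoint_op_Re:
  assumes T: "bounded_clinear T"
  shows "self_adjoint (op_Re T)"
  unfolding self_adjoint_iff op_Re_def
  by (auto intro!: bounded_clinear_scaleR bounded_clinear_add bounded_clinear_cadjoint T
      simp: cinner_linear cinner_cadjoint[OF T] cinner_cadjoint_left[OF T] add.commute)

lemma contraction_op_Re:
  assumes T: "contraction T"
  shows "contraction (op_Re T)"
proof -
  have lin: "bounded_clinear T" using T by (simp add: contraction_def)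
  have "norm (op_Re T x) \<le> 1 * norm x" for x
    using norm_triangle_ineq[of "T x" "cadjoint T x"] norm_contraction_le[OF T, of x]
      norm_cadjoint_contraction_le[OF T, of x]
    by (simp add: op_Re_def del: scaleR_add_right)
  then show ?thesis
    unfolding contraction_def
    using self_adjointD(1)[OF self_adjoint_op_Re[OF lin]] by (auto intro!: onorm_bound)
qed

section \<open>Quasi-isometric contractions\<close>

text \<open>This replaces an orthogonal decomposition along the closure of the range of
  \<open>U\<close>: by skewness all values of \<open>Z\<close> are orthogonal to that range, so
  \<open>Z\<close> vanishes on them, and skewness again turns Z(Zy) = 0 into Zy = 0.\<close>

lemma skew_adjoint_eq_zero:
  fixes Z U :: "'a::complex_inner \<Rightarrow> 'a"
  assumes skew: "\<And>x y. cinner (Z x) y = - cinner x (Z y)"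
    and "\<And>x. Z (U x) = 0"
    and orth: "\<And>y. (\<And>x. cinner y (U x) = 0) \<Longrightarrow> Z y = 0"
  shows "Z y = 0"
proof -
  have "Z (Z y) = 0" by (rule orth) (simp add: skew assms(2))
  then have "cinner (Z y) (Z y) = 0" by (simp add: skew)
  then show ?thesis by (simp add: cinner_self)
qed

theorem corollary3p4:
  fixes T :: "'a::chilbert_space \<Rightarrow> 'a"
  assumes "contraction T"
    and "quasi_isometry 2 T"
    and "op_le (op_abs T) (op_abs (op_Re T))"
  shows "self_adjoint T"
proof -
  have lin: "bounded_clinear T" using assms(1) by (simp add: contraction_def)
  define T' where "T' = cadjoint T"
  define A where "A = op_Re T"
  define S where "S = op_abs T"
  define R where "R = op_abs A"
  note TD = bounded_clinearD[OF lin]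
  have lin': "bounded_clinear T'" unfolding T'_def by (rule bounded_clinear_cadjoint[OF lin])
  note T'D = bounded_clinearD[OF lin']
  have adj: "cinner (T x) y = cinner x (T' y)" for x y
    unfolding T'_def by (rule cinner_cadjoint[OF lin])
  have adj': "cinner (T' x) y = cinner x (T y)" for x y
    unfolding T'_def by (rule cinner_cadjoint_left[OF lin])
  have T_le: "norm (T x) \<le> norm x" for x by (rule norm_contraction_le[OF assms(1)])
  have T'_le: "norm (T' x) \<le> norm x" for x
    unfolding T'_def by (rule norm_cadjoint_contraction_le[OF assms(1)])
  have A: "A x = (1/2) *\<^sub>R (T x + T' x)" for x by (simp add: A_def op_Re_def T'_def)
  have A_contr: "contraction A" unfolding A_def by (rule contraction_op_Re[OF assms(1)])
  have A_sa: "self_adjoint A" unfolding A_def by (rule self_adjoint_op_Re[OF lin])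
  have cadj_A: "cadjoint A = A" using A_sa by (simp add: self_adjoint_def)
  note AD = bounded_clinearD[OF self_adjointD(1)[OF A_sa]]
  have S_pos: "positive_op S" and SS: "S (S x) = T' (T x)" for x
    unfolding S_def T'_def by (fact positive_op_abs[OF assms(1)] op_abs_op_abs[OF assms(1)])+
  have R_pos: "positive_op R" and RR: "R (R x) = A (A x)" for x
    using positive_op_abs[OF A_contr] op_abs_op_abs[OF A_contr] by (auto simp: R_def cadj_A)
  have S_lin: "bounded_clinear S" and R_lin: "bounded_clinear R"
    using S_pos R_pos by (auto simp: positive_op_iff self_adjoint_iff)
  note SD = bounded_clinearD[OF S_lin]
  have S_le_R: "Re (cinner (S x) x) \<le> Re (cinner (R x) x)" for x
    using op_leD[OF assms(3)] by (simp add: S_def R_def A_def)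

  \<comment> \<open>Action on the range of the square of T\<close>
  define U where "U = (\<lambda>x. T (T x))"
  have iso: "norm (T (U x)) = norm (U x)" for x
    using assms(2) by (auto simp: quasi_isometry_def U_def numeral_2_eq_2)
  have U_T: "T (U x) = U (T x)" for x by (simp add: U_def)
  \<comment> \<open>The equality case of Cauchy-Schwarz: the inner product with \<open>U x\<close>
    already has the largest value that a vector of norm at most norm (U x) allows.\<close>
  have TT_U: "T' (T (U x)) = U x" for x
  proof -
    have "Re (cinner (T' (T (U x))) (U x)) = (norm (U x))\<^sup>2"
      by (simp add: adj' Re_cinner_self iso)
    moreover have "(norm (T' (T (U x))))\<^sup>2 \<le> (norm (U x))\<^sup>2"
      using T'_le[of "T (U x)"] by (simp add: iso power_mono)
    ultimately have "(norm (T' (T (U x)) - U x))\<^sup>2 \<le> 0"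
      by (simp add: norm_diff_square)
    then show ?thesis by simp
  qed
  \<comment> \<open>At \<open>U x\<close> the squares of \<open>S\<close> and of the identity
    agree.\<close>
  have S_U: "S (U x) = U x" for x
  proof -
    have "positive_op (\<lambda>x::'a. x)"
      by (simp add: positive_op_iff self_adjoint_iff bounded_clinear_ident Re_cinner_self)
    then show ?thesis
      by (rule commuting_positive_eq[OF S_pos]) (simp_all add: SS TT_U)
  qed
  have T'_U: "T' (U x) = T (U x)" for x
  proof -
    have "norm (U x) * norm (U x) \<le> Re (cinner (R (U x)) (U x))"
      using S_le_R[of "U x"] by (simp add: S_U Re_cinner_self power2_eq_square)
    also have "\<dots> \<le> norm (A (U x)) * norm (U x)"
      using Re_cinner_le[of "R (U x)" "U x"] by (simp add: R_def norm_op_abs[OF A_contr])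
    finally have "norm (U x) \<le> norm (A (U x))"
      by (cases "U x = 0") simp_all
    then have "2 * norm (U x) \<le> norm (T (U x) + T' (U x))"
      by (simp add: A del: scaleR_add_right)
    then have "4 * (norm (U x))\<^sup>2 \<le> (norm (T (U x) + T' (U x)))\<^sup>2"
      using power_mono[of "2 * norm (U x)" _ 2] by (simp add: power_mult_distrib)
    moreover have "(norm (T (U x)))\<^sup>2 \<le> (norm (U x))\<^sup>2" "(norm (T' (U x)))\<^sup>2 \<le> (norm (U x))\<^sup>2"
      by (intro power_mono T_le T'_le norm_ge_zero)+
    \<comment> \<open>In the parallelogram law the sum already uses up the whole bound of four times
      the square of norm (U x).\<close>
    ultimately have "(norm (T (U x) - T' (U x)))\<^sup>2 \<le> 0"
      using parallelogram[of "T (U x)" "T' (U x)"] by linarith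
    then show ?thesis by simp
  qed
  have A_U: "A (U x) = T (U x)" for x
    by (simp add: A T'_U scaleR_half_double del: scaleR_add_right)
  \<comment> \<open>Since \<open>T (U x)\<close> is again in the range of \<open>U\<close>, both
    factors \<open>A\<close> act as \<open>T\<close>, and the outer one also as \<open>T'\<close>,
    so \<open>TT_U\<close> applies.\<close>
  have AA_U: "A (A (U x)) = U x" for x
    by (metis A_U U_T T'_U TT_U)

  \<comment> \<open>The orthogonal complement of that range\<close>
  define N where "N = {y. \<forall>x. cinner y (U x) = 0}"
  have T_N: "T y \<in> N" and T'_N: "T' y \<in> N" if "y \<in> N" for y
    using that by (auto simp: N_def adj adj' T'_U) (metis U_T)+
  have T'T'_N: "T' (T' y) = 0" if "y \<in> N" for y
  proof -
    have "cinner (T' (T' y)) (T' (T' y)) = cinner y (U (T' (T' y)))" by (simp add: adj' U_def)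
    then show ?thesis using that by (simp add: N_def cinner_self)
  qed
  have TT_N: "T (T y) = 0" if "y \<in> N" for y
  proof -
    \<comment> \<open>The vector \<open>T (T y)\<close> is \<open>U y\<close> itself and also lies
      in \<open>N\<close>, so it is orthogonal to itself.\<close>
    have "cinner (T (T y)) (U y) = 0" using T_N[OF T_N[OF that]] by (simp add: N_def)
    then show ?thesis by (simp add: U_def cinner_self)
  qed
  have AA_N: "A (A y) = (1/4) *\<^sub>R (T (T' y) + T' (T y))" if "y \<in> N" for y
    using TT_N[OF that] T'T'_N[OF that] by (simp add: A TD T'D algebra_simps)

  \<comment> \<open>the commutator is skew-adjoint and vanishes on \<open>range U\<close> and on \<open>N\<close>\<close>
  have AA_SS: "A (A (T' (T y))) = T' (T (A (A y)))" for y
  proof -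
    define Z where "Z = (\<lambda>y. A (A (T' (T y))) - T' (T (A (A y))))"
    have "Z y = 0"
    proof (rule skew_adjoint_eq_zero[of Z U])
      show "cinner (Z x) y = - cinner x (Z y)" for x y
        by (simp add: Z_def cinner_linear adj adj' self_adjointD(2)[OF A_sa])
      show "Z (U x) = 0" for x by (simp add: Z_def TT_U AA_U)
    next
      fix y assume "\<And>x. cinner y (U x) = 0"
      then have y: "y \<in> N" by (simp add: N_def)
      \<comment> \<open>These memberships kill every term with two adjacent equal factors; both
        products reduce to a quarter of T' T T' T y.\<close>
      note N = y T_N[OF y] T'_N[OF y] T'_N[OF T_N[OF y]]
      show "Z y = 0"
        using N by (simp add: Z_def AA_N TD T'D TT_N T'T'_N)
    qed
    then show ?thesis by (simp add: Z_def)
  qed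
  \<comment> \<open>Commutation passes to the roots one at a time: from T'T to its root
    \<open>S\<close>, then from AA to its root \<open>R\<close>.\<close>
  have AA_S: "A (A (S x)) = S (A (A x))" for x
    unfolding S_def
    by (rule op_abs_commute[OF assms(1), of "\<lambda>x. A (A x)"])
      (use AA_SS bounded_linear_compose[OF AD(1) AD(1)] in \<open>simp_all add: T'_def\<close>)
  have SR: "S (R x) = R (S x)" for x
    unfolding R_def
    by (rule op_abs_commute[OF A_contr, of S]) (simp_all add: cadj_A AA_S SD(1))

  have T'_zero: "T' w = 0" if w: "w \<in> N" for w
  proof -
    let ?H = "\<lambda>x. (1/2) *\<^sub>R S x"
    have H: "positive_op ?H"
      using S_pos by (auto simp: positive_op_iff self_adjoint_iff cinner_linear bounded_clinear_scaleR)
    \<comment> \<open>On \<open>T' w\<close> the summand T T' of the formula \<open>AA_N\<close>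
      drops out because \<open>T' (T' w)\<close> is 0, leaving a quarter of T'T.\<close>
    have "R (R (T' w)) = ?H (?H (T' w))"
      using w T'_N[OF w] by (simp add: RR AA_N SS SD T'T'_N T'D TD)
    then have "R (T' w) = ?H (T' w)"
      by (rule commuting_positive_eq[OF R_pos H, rotated]) (simp add: bounded_clinearD(7)[OF R_lin] SR)
    \<comment> \<open>The hypothesis on moduli now bounds a nonnegative number by its own
      half.\<close>
    then have "Re (cinner (S (T' w)) (T' w)) \<le> Re (cinner (S (T' w)) (T' w)) / 2"
      using S_le_R[of "T' w"] by (simp add: cinner_linear)
    moreover have "0 \<le> Re (cinner (S (T' w)) (T' w))"
      using S_pos by (simp add: positive_op_iff)
    ultimately have "S (T' w) = 0" by (intro positive_op_eq_zero[OF S_pos]) simp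
    then have "T (T' w) = 0" using norm_op_abs[OF assms(1), of "T' w"] by (simp add: S_def)
    then have "cinner (T' w) (T' w) = 0" by (simp add: adj')
    then show ?thesis by (simp add: cinner_self)
  qed
  \<comment> \<open>Since \<open>T w\<close> is in \<open>N\<close>, \<open>T'\<close> annihilates
    it, and the square of norm (T w) is the inner product of w with T'(T w).\<close>
  have T_zero: "T w = 0" if "w \<in> N" for w
    using T'_zero[OF T_N[OF that]] adj[of w "T w"] by (simp add: cinner_self)

  have "T y - T' y = 0" for y
  proof (rule skew_adjoint_eq_zero[of "\<lambda>y. T y - T' y" U])
    show "cinner (T x - T' x) y = - cinner x (T y - T' y)" for x y
      by (simp add: cinner_linear adj adj')
  qed (simp_all add: T'_U T_zero T'_zero N_def)
  then have "cadjoint T = T" by (auto simp: T'_def)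
  then show ?thesis using lin by (simp add: self_adjoint_def)
qed

end
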